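(* Suppose $\mathbb{X}$ is compact with finite radius $r$, i.e. $\|x-x'\|\le r<\infty$ for all $x,x'\in\mathbb{X}$. Let $(x^k)$ be the iterates of the stochastic Krasnosel'skii–Mann iteration $$x^{k+1}=x^{k}+\lambda_{k}\big(T(x^{k})-x^{k}+\epsilon_{k}\big),\qquad \lambda_k\in(0,1),$$ of a nonexpansive operator $T:\mathbb{X}\to\mathbb{X}$ with stochastic errors $\epsilon_k$. Put $e_k=Tx^k-x^k$, $\Lambda_K=\sum_{k=1}^K\lambda_k$ and $\bar e_K=\Lambda_K^{-1}\sum_{k=1}^K\lambda_k e_k$. Then $$\mathbb{E}\|\bar e_K\|\le\frac{2r(1+\phi(1))+2\sum_{k=1}^K\mathbb{E}\|\lambda_k\epsilon_k\|}{\Lambda_K}.$$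
   Context: Setting. $\Xi$ is a sample space with probability distribution $\mathbb{P}$, and $\mathbb{X}\subset\mathbb{R}^d$ is a convex feasible parameter set. Samples $\xi_1,\xi_2,\dots$ come from an ergodic stochastic process converging to the stationary distribution $\mathbb{P}$ (they need not be independent). Iteration. $T$ is nonexpansive: $\|Tx-Ty\|\le\|x-y\|$ for all $x,y\in\mathbb{X}$; it is assumed that $\operatorname{Fix}(T)=\{x\in\mathbb{X}:x=T(x)\}\ne\emptyset$. The starting point $x^0\in\mathbb{X}$ is arbitrary and all iterates lie in $\mathbb{X}$. The error $\epsilon_k$ is caused by the randomness of the samples: step $k+1$ is computed with the sample $\xi_{k+1}$, $x^{k+1}=x^k+\lambda_k(T(x^k;\xi_{k+1})-x^k)$, so that $T(x^k;\xi_{k+1})=T(x^k)+\epsilon_k$. Mixing. The total variation distance is $d_{\mathrm{TV}}(\mathbb{P},\mathbb{Q})=\sup_{A\subset\Xi}|\mathbb{P}(A)-\mathbb{Q}(A)|$ (supremum over measurable $A$). With $\mathcal{F}_0=\{\emptyset,\Omega\}$ and $\mathcal{F}_k=\sigma(\xi_1,\dots,\xi_k)$, the $\phi$-mixing coefficients are $\phi(l)=\sup_{k\in\mathbb{N}^+,\,B\in\mathcal{F}_k}\{2\,d_{\mathrm{TV}}(P^{k+l}(\cdot\mid B),\mathbb{P})\}$, where $P^{k+l}(\cdot\mid B)$ is the conditional distribution of $\xi_{k+l}$ given $B$. *)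

theory Defs
  imports "HOL-Probability.Probability"
begin

definition tv_dist :: "'a measure \<Rightarrow> 'a measure \<Rightarrow> real" where
  "tv_dist P Q = (SUP A\<in>sets P. \<bar>measure P A - measure Q A\<bar>)"

text \<open>The process is indexed from 1, so \<open>past_events M \<Xi> \<xi> 0\<close> is the trivial sigma-algebra.\<close>

definition past_events :: "'w measure \<Rightarrow> 's measure \<Rightarrow> (nat \<Rightarrow> 'w \<Rightarrow> 's) \<Rightarrow> nat \<Rightarrow> 'w set set" where
  "past_events M \<Xi> \<xi> k =
     sigma_sets (space M) (\<Union>i\<in>{1..k}. {\<xi> i -` A \<inter> space M | A. A \<in> sets \<Xi>})"

text \<open>The measure \<open>uniform_measure M B\<close> is M conditioned on the event B; conditioning is
  meaningful only for events of positive probability.\<close>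

definition cond_distr :: "'w measure \<Rightarrow> 's measure \<Rightarrow> ('w \<Rightarrow> 's) \<Rightarrow> 'w set \<Rightarrow> 's measure" where
  "cond_distr M \<Xi> X B = distr (uniform_measure M B) \<Xi> X"

text \<open>The measure P plays two roles: its sigma-algebra is that of the sample space, and it is the
  stationary distribution. The supremum below is a supremum of reals; for random variables with
  values in P it ranges over a nonempty set bounded by 2.\<close>

definition phi_mixing :: "'w measure \<Rightarrow> 's measure \<Rightarrow> (nat \<Rightarrow> 'w \<Rightarrow> 's) \<Rightarrow> nat \<Rightarrow> real" where
  "phi_mixing M P \<xi> l =
     (SUP (k, B) \<in> {(k, B). 1 \<le> k \<and> B \<in> past_events M P \<xi> k \<and> measure M B > 0}.
        2 * tv_dist (cond_distr M P (\<xi> (k + l)) B) P)"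

text \<open>Convergence: the law of the k-th sample tends to P in total variation. Ergodicity: almost
  surely, time averages of indicators of events agree with their probabilities under P. Neither
  requires the process itself to be stationary. Both hold whenever the mixing coefficients tend
  to 0.\<close>

definition ergodic_to :: "'w measure \<Rightarrow> (nat \<Rightarrow> 'w \<Rightarrow> 's) \<Rightarrow> 's measure \<Rightarrow> bool" where
  "ergodic_to M \<xi> P \<longleftrightarrow>
     (\<forall>k\<ge>1. \<xi> k \<in> measurable M P) \<and>
     (\<lambda>k. tv_dist (distr M P (\<xi> k)) P) \<longlonglongrightarrow> 0 \<and>
     (\<forall>A\<in>sets P. AE \<omega> in M.
        (\<lambda>n. (\<Sum>k=1..n. indicat_real A (\<xi> k \<omega>)) / real n) \<longlonglongrightarrow> measure P A)"

definition avg_residual ::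
    "(nat \<Rightarrow> real) \<Rightarrow> ('v::real_normed_vector \<Rightarrow> 'v) \<Rightarrow> (nat \<Rightarrow> 'v) \<Rightarrow> nat \<Rightarrow> 'v" where
  "avg_residual l T x K = (1 / (\<Sum>k=1..K. l k)) *\<^sub>R (\<Sum>k=1..K. l k *\<^sub>R (T (x k) - x k))"

end

theory Submission
  imports Defs
begin

text \<open>The iteration telescopes: the weighted sum of residuals equals the total displacement of the
  iterates, of norm at most r, minus the weighted sum of errors. This gives a bound with r in place
  of \<open>2 * r * (1 + \<phi>(1))\<close> and with the factor 1 in front of the errors, so the mixing coefficient
  enters only through \<open>\<phi>(1) \<ge> 0\<close>.\<close>

text \<open>A supremum of reals is informative only over a nonempty set that is bounded above.
  Probabilities lie in [0,1], so every difference is at most 1 in absolute value; the empty event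
  contributes 0.\<close>

lemma tv_dist_bounds:
  assumes "prob_space P" "prob_space Q"
  shows tv_dist_nonneg: "0 \<le> tv_dist P Q" and tv_dist_le_1: "tv_dist P Q \<le> 1"
proof -
  have diff: "\<bar>measure P A - measure Q A\<bar> \<le> 1" for A
    using prob_space.prob_le_1[OF assms(1), of A] prob_space.prob_le_1[OF assms(2), of A]
      measure_nonneg[of P A] measure_nonneg[of Q A] by linarith
  then have bdd: "bdd_above ((\<lambda>A. \<bar>measure P A - measure Q A\<bar>) ` sets P)"
    by (auto intro!: bdd_aboveI2)
  show "0 \<le> tv_dist P Q"
    unfolding tv_dist_def by (rule cSUP_upper2[OF bdd sets.empty_sets]) simp
  show "tv_dist P Q \<le> 1"
    unfolding tv_dist_def by (rule cSUP_least) (use diff in auto)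
qed

lemma prob_space_cond_distr:
  assumes "X \<in> measurable M \<Xi>" "measure M B > 0"
  shows "prob_space (cond_distr M \<Xi> X B)"
proof -
  \<comment> \<open>\<open>measure\<close> sends an infinite \<open>emeasure\<close> to 0, so a
    positive value excludes both extremes.\<close>
  have "emeasure M B \<noteq> 0" "emeasure M B \<noteq> \<infinity>"
    using assms(2) by (auto simp: measure_def)
  then have "prob_space (uniform_measure M B)"
    by (rule prob_space_uniform_measure)
  moreover have "X \<in> measurable (uniform_measure M B) \<Xi>"
    using assms(1) by (simp cong: measurable_cong_sets)
  ultimately show ?thesis
    unfolding cond_distr_def by (rule prob_space.prob_space_distr)
qed

text \<open>All members of the family are nonnegative, but their real supremum inherits this only
  once the family is known to be bounded above and nonempty.\<close>

lemma phi_mixing_nonneg: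
  assumes "prob_space M" "prob_space P" "\<And>k. 1 \<le> k \<Longrightarrow> \<xi> k \<in> measurable M P"
  shows "0 \<le> phi_mixing M P \<xi> l"
proof -
  let ?I = "{(k, B). 1 \<le> k \<and> B \<in> past_events M P \<xi> k \<and> measure M B > 0}"
  let ?f = "\<lambda>(k, B). 2 * tv_dist (cond_distr M P (\<xi> (k + l)) B) P"
  have bounds: "0 \<le> ?f p \<and> ?f p \<le> 2" if p_in: "p \<in> ?I" for p
  proof -
    obtain k B where p: "p = (k, B)" "1 \<le> k" "measure M B > 0"
      using p_in by auto
    then have "prob_space (cond_distr M P (\<xi> (k + l)) B)"
      by (intro prob_space_cond_distr assms(3)) auto
    from tv_dist_bounds[OF this assms(2)] p(1) show ?thesis by simp
  qed
  \<comment> \<open>The sure event lies in every sigma-algebra and has probability 1, so it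
    witnesses that the index set is nonempty.\<close>
  have top: "(1, space M) \<in> ?I"
    using prob_space.prob_space[OF assms(1)] by (simp add: past_events_def sigma_sets_top)
  have "bdd_above (?f ` ?I)"
    using bounds by (auto intro!: bdd_aboveI2[where M = 2])
  from cSUP_upper2[OF this top] bounds[OF top] show ?thesis
    unfolding phi_mixing_def by blast
qed

text \<open>Solved for the weighted residual, the recursion gives the increment
  \<open>x (Suc k) - x k\<close> minus the weighted error. The sum starts at 1, so the increments
  collapse to a displacement from \<open>x 1\<close>, not from \<open>x 0\<close>.\<close>

lemma km_sum_residuals:
  fixes x e :: "nat \<Rightarrow> 'v::real_vector"
  assumes "\<And>k. x (Suc k) = x k + l k *\<^sub>R (T (x k) - x k + e k)"
  shows "(\<Sum>k=1..K. l k *\<^sub>R (T (x k) - x k)) = x (Suc K) - x 1 - (\<Sum>k=1..K. l k *\<^sub>R e k)"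
proof (induction K)
  case (Suc K)
  then show ?case
    using assms[of "Suc K"] by (simp add: algebra_simps)
qed simp

theorem theorem4:
  fixes M :: "'w measure" and P :: "'s measure"
    and \<xi> :: "nat \<Rightarrow> 'w \<Rightarrow> 's"
    and X :: "(real ^ 'd) set" and r :: real
    and T :: "real ^ 'd \<Rightarrow> real ^ 'd"
    and Ts :: "real ^ 'd \<Rightarrow> 's \<Rightarrow> real ^ 'd"
    and lam :: "nat \<Rightarrow> real"
    and x0 :: "real ^ 'd"
    and x \<epsilon> :: "nat \<Rightarrow> 'w \<Rightarrow> real ^ 'd"
    and K :: nat
  assumes prob_M: "prob_space M"
    and prob_P: "prob_space P"
    and ergodic: "ergodic_to M \<xi> P"
    and convex_X: "convex X"
    and compact_X: "compact X"
    and radius: "\<forall>y\<in>X. \<forall>z\<in>X. norm (y - z) \<le> r"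
    and T_maps: "T \<in> X \<rightarrow> X"
    and T_nonexpansive: "\<forall>y\<in>X. \<forall>z\<in>X. norm (T y - T z) \<le> norm (y - z)"
    and T_fixpoint: "{y \<in> X. y = T y} \<noteq> {}"
    and lam: "\<forall>k. 0 < lam k \<and> lam k < 1"
    and x0: "x0 \<in> X"
    and start: "\<forall>\<omega>\<in>space M. x 0 \<omega> = x0"
    and iterates: "\<forall>k. \<forall>\<omega>\<in>space M. x k \<omega> \<in> X"
    and iteration: "\<forall>k. \<forall>\<omega>\<in>space M.
          x (Suc k) \<omega> = x k \<omega> + lam k *\<^sub>R (T (x k \<omega>) - x k \<omega> + \<epsilon> k \<omega>)"
    and error: "\<forall>k. \<forall>\<omega>\<in>space M. Ts (x k \<omega>) (\<xi> (Suc k) \<omega>) = T (x k \<omega>) + \<epsilon> k \<omega>"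
    and error_measurable: "\<forall>k. \<epsilon> k \<in> borel_measurable M"
    and K: "1 \<le> K"
  shows "prob_space.expectation M (\<lambda>\<omega>. norm (avg_residual lam T (\<lambda>k. x k \<omega>) K))
     \<le> (2 * r * (1 + phi_mixing M P \<xi> 1)
          + 2 * (\<Sum>k=1..K. prob_space.expectation M (\<lambda>\<omega>. norm (lam k *\<^sub>R \<epsilon> k \<omega>))))
        / (\<Sum>k=1..K. lam k)"
proof -
  interpret prob_space M by (fact prob_M)
  let ?L = "\<Sum>k=1..K. lam k"
  let ?res = "\<lambda>\<omega>. \<Sum>k=1..K. lam k *\<^sub>R (T (x k \<omega>) - x k \<omega>)"
  let ?bnd = "\<lambda>\<omega>. (r + (\<Sum>k=1..K. norm (lam k *\<^sub>R \<epsilon> k \<omega>))) / ?L"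
  have L: "0 < ?L"
    using lam K by (intro sum_pos) auto
  have r: "0 \<le> r"
    using radius x0 by fastforce
  have phi: "0 \<le> phi_mixing M P \<xi> 1"
    using ergodic by (intro phi_mixing_nonneg prob_M prob_P) (simp add: ergodic_to_def)
  \<comment> \<open>Integrability is what allows the expectation of the error sum to be split later.
    The constant \<open>2 * r\<close> is one \<open>r\<close> for the step between iterates and one
    for the residual, whose weight is below 1.\<close>
  have err_int: "integrable M (\<lambda>\<omega>. norm (lam k *\<^sub>R \<epsilon> k \<omega>))" for k
  proof (rule integrable_const_bound[where B = "2 * r"])
    have [measurable]: "\<epsilon> k \<in> borel_measurable M"
      using error_measurable by simp
    have "norm (lam k *\<^sub>R \<epsilon> k \<omega>) \<le> 2 * r" if \<omega>: "\<omega> \<in> space M" for \<omega>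
    proof -
      have X: "x k \<omega> \<in> X" "x (Suc k) \<omega> \<in> X" "T (x k \<omega>) \<in> X"
        using iterates \<omega> T_maps by auto
      have "lam k *\<^sub>R \<epsilon> k \<omega> = (x (Suc k) \<omega> - x k \<omega>) - lam k *\<^sub>R (T (x k \<omega>) - x k \<omega>)"
        using iteration \<omega> by (simp add: algebra_simps)
      also have "norm \<dots> \<le> norm (x (Suc k) \<omega> - x k \<omega>) + lam k * norm (T (x k \<omega>) - x k \<omega>)"
        using norm_triangle_ineq4[of "x (Suc k) \<omega> - x k \<omega>" "lam k *\<^sub>R (T (x k \<omega>) - x k \<omega>)"] lam
        by (simp add: less_imp_le abs_of_pos)
      also have "\<dots> \<le> r + 1 * r"
        using radius X lam by (intro add_mono mult_mono) (auto simp: less_imp_le)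
      finally show ?thesis by simp
    qed
    then show "AE \<omega> in M. norm (norm (lam k *\<^sub>R \<epsilon> k \<omega>)) \<le> 2 * r" by simp
    show "(\<lambda>\<omega>. norm (lam k *\<^sub>R \<epsilon> k \<omega>)) \<in> borel_measurable M"
      by measurable
  qed
  have "expectation (\<lambda>\<omega>. norm (avg_residual lam T (\<lambda>k. x k \<omega>) K)) \<le> expectation ?bnd"
  \<comment> \<open>This rule asks for integrability and nonnegativity of the upper bound only: a
    left-hand integrand that is not integrable has integral 0 by default.\<close>
  proof (rule integral_mono')
    show "integrable M ?bnd"
      using err_int by auto
    fix \<omega> assume \<omega>: "\<omega> \<in> space M"
    have "?res \<omega> = x (Suc K) \<omega> - x 1 \<omega> - (\<Sum>k=1..K. lam k *\<^sub>R \<epsilon> k \<omega>)"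
      using iteration \<omega> by (intro km_sum_residuals[where x = "\<lambda>k. x k \<omega>"]) simp
    also have "norm \<dots> \<le> norm (x (Suc K) \<omega> - x 1 \<omega>) + norm (\<Sum>k=1..K. lam k *\<^sub>R \<epsilon> k \<omega>)"
      by (rule norm_triangle_ineq4)
    also have "\<dots> \<le> r + (\<Sum>k=1..K. norm (lam k *\<^sub>R \<epsilon> k \<omega>))"
      using radius iterates \<omega> by (intro add_mono norm_sum) auto
    finally have "norm (?res \<omega>) \<le> r + (\<Sum>k=1..K. norm (lam k *\<^sub>R \<epsilon> k \<omega>))" .
    moreover have "norm (avg_residual lam T (\<lambda>k. x k \<omega>) K) = norm (?res \<omega>) / ?L"
      using L by (simp add: avg_residual_def)
    ultimately show "norm (avg_residual lam T (\<lambda>k. x k \<omega>) K) \<le> ?bnd \<omega>"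
      using L by (simp only: divide_right_mono less_imp_le)
  qed (use L r in \<open>simp add: sum_nonneg\<close>)
  also have "expectation ?bnd = (r + (\<Sum>k=1..K. expectation (\<lambda>\<omega>. norm (lam k *\<^sub>R \<epsilon> k \<omega>)))) / ?L"
    \<comment> \<open>Deleting \<open>norm_scaleR\<close> keeps the integrands in the form of
      \<open>err_int\<close>; total mass 1 turns the constant \<open>r\<close> into its own
      expectation.\<close>
    using err_int by (simp add: prob_space del: norm_scaleR)
  also have "\<dots> \<le> (2 * r * (1 + phi_mixing M P \<xi> 1)
      + 2 * (\<Sum>k=1..K. expectation (\<lambda>\<omega>. norm (lam k *\<^sub>R \<epsilon> k \<omega>)))) / ?L"
  \<comment> \<open>Only slack is added here: the surplus of the right numerator is
    \<open>r\<close>, twice \<open>r * phi_mixing M P \<xi> 1\<close>, and one more copy of the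
    error sum, all nonnegative.\<close>
  proof (rule divide_right_mono)
    have "0 \<le> (\<Sum>k=1..K. expectation (\<lambda>\<omega>. norm (lam k *\<^sub>R \<epsilon> k \<omega>)))"
      by (intro sum_nonneg integral_nonneg) simp
    moreover have "0 \<le> r * phi_mixing M P \<xi> 1"
      using r phi by simp
    ultimately show "r + (\<Sum>k=1..K. expectation (\<lambda>\<omega>. norm (lam k *\<^sub>R \<epsilon> k \<omega>)))
      \<le> 2 * r * (1 + phi_mixing M P \<xi> 1)
        + 2 * (\<Sum>k=1..K. expectation (\<lambda>\<omega>. norm (lam k *\<^sub>R \<epsilon> k \<omega>)))"
      using r unfolding distrib_left by linarith
  qed (use L in simp)
  finally show ?thesis .
qed

end
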